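(* Let $T$ be a normal, steep rank-one transformation. Then $T$ is not rationally weakly mixing.
   Context: Rank-one transformations. A column is a finite ordered collection of pairwise disjoint intervals of $\mathbb{R}$ (called levels), all of the same length, thought of as stacked on top of each other. The column map $T_C$ of a column $C$ sends each point of a level other than the top one to the point directly above it in the next level (by translation); it is undefined on the top level. A rank-one (cutting-and-stacking) transformation $T$ is given by a sequence of columns $C_n$, $n\ge 0$: $C_0$ consists of the single level $I=(0,1)$; $C_{n+1}$ is obtained from $C_n$ by cutting $C_n$ into $r_n\ge 2$ subcolumns of equal width (numbered $0,\dots,r_n-1$ from left to right), adding $s_{n,k}\ge 0$ new levels ("spacers", new disjoint intervals) above the $k$-th subcolumn, and stacking every subcolumn under the subcolumn to its right. $X$ is the union of all levels of all columns, with Lebesgue measure $\mu$ and its Borel $\sigma$-algebra, and the levels are required to form a generating semiring for the $\sigma$-algebra. $T_{C_{n+1}}$ extends $T_{C_n}$, and $T$ is the limit of the $T_{C_n}$; it is an invertible measure-preserving transformation of $X$ (mod null sets). $h_n$ denotes the number of levels of $C_n$, and $h_{n,k}=h_n+s_{n,k}$. $T$ is normal if $s_{n,r_n-1}>0$ for infinitely many $n$. For $j\ge 0$ let $H_j=\{0\}\cup\{\sum_{k=0}^i h_{j,k}:0\le i<r_j-1\}$, and let $H=\bigcup_{j\ge 0}H_j\setminus\{0\}$, listed in increasing order (the nonzero elements of $H_0$ in increasing order, then those of $H_1$, and so on) as $t_1<t_2<\cdots$. $T$ is steep if $t_{i+1}\ge 4t_i$ for every pair of successive elements $t_i,t_{i+1}$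 of $H$. For measurable $F$ with $0<\mu(F)<\infty$, $u_k(F)=\mu(F\cap T^kF)/\mu(F)^2$ and $a_n(F)=\sum_{k=0}^{n-1}u_k(F)$. $T$ is rationally weakly mixing if there exists a measurable $F\subset X$ with $0<\mu(F)<\infty$ such that for all measurable $A,B\subset F$, $$\frac{1}{a_n(F)}\sum_{k=0}^{n-1}\left|\mu(A\cap T^kB)-\mu(A)\mu(B)u_k(F)\right|\to 0\quad\text{as } n\to\infty.$$ *)

theory Defs
  imports "HOL-Analysis.Analysis" "HOL-Library.Infinite_Set"
begin

text \<open>
  Levels are half-open intervals \<open>[a, a + w)\<close>, so that cutting a level partitions it exactly and the
  construction holds pointwise rather than only modulo null sets.  A column is given by the common
  width of its levels and by the list of their left endpoints, from bottom to top.
\<close>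

record level_column =
  width :: real
  lefts :: "real list"

definition height :: "level_column \<Rightarrow> nat" where
  "height C = length (lefts C)"

definition level :: "level_column \<Rightarrow> nat \<Rightarrow> real set" where
  "level C i = {lefts C ! i ..< lefts C ! i + width C}"

definition is_column :: "level_column \<Rightarrow> bool" where
  "is_column C \<longleftrightarrow>
     width C > 0 \<and> lefts C \<noteq> [] \<and> disjoint_family_on (level C) {..<height C}"

definition extends_column_map :: "(real \<Rightarrow> real) \<Rightarrow> level_column \<Rightarrow> bool" where
  "extends_column_map T C \<longleftrightarrow>
     (\<forall>i x. Suc i < height C \<longrightarrow> x \<in> level C i \<longrightarrow>
        T x = x + (lefts C ! Suc i - lefts C ! i))"

text \<open>
  In \<open>cut_and_stack C r s C'\<close>, \<open>sp k\<close> lists the left endpoints of the \<open>s k\<close> spacers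
  put above the \<open>k\<close>-th subcolumn.  Their disjointness from each other and from \<open>C\<close> is not stated
  here; it is the requirement that \<open>C'\<close> be a column.
\<close>

definition cut_and_stack ::
    "level_column \<Rightarrow> nat \<Rightarrow> (nat \<Rightarrow> nat) \<Rightarrow> level_column \<Rightarrow> bool" where
  "cut_and_stack C r s C' \<longleftrightarrow>
     width C' = width C / real r \<and>
     (\<exists>sp :: nat \<Rightarrow> real list.
        (\<forall>k<r. length (sp k) = s k) \<and>
        lefts C' =
          concat (map (\<lambda>k. map (\<lambda>a. a + real k * (width C / real r)) (lefts C) @ sp k) [0..<r]))"

definition all_levels :: "(nat \<Rightarrow> level_column) \<Rightarrow> real set set" where
  "all_levels C = {level (C n) i | n i. i < height (C n)}"

definition rank_one_space :: "(nat \<Rightarrow> level_column) \<Rightarrow> real measure" where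
  "rank_one_space C = restrict_space lborel (\<Union>(all_levels C))"

text \<open>
  \<open>T\<close> is unconstrained outside the space.  On the space it is determined everywhere: no point lies
  in the top level of all but finitely many columns, because the levels are open on the right.
\<close>

definition rank_one ::
    "(nat \<Rightarrow> nat) \<Rightarrow> (nat \<Rightarrow> nat \<Rightarrow> nat) \<Rightarrow> (nat \<Rightarrow> level_column) \<Rightarrow> (real \<Rightarrow> real) \<Rightarrow> bool" where
  "rank_one r s C T \<longleftrightarrow>
     C 0 = \<lparr>width = 1, lefts = [0]\<rparr> \<and>
     (\<forall>n. is_column (C n)) \<and>
     (\<forall>n. r n \<ge> 2 \<and> cut_and_stack (C n) (r n) (s n) (C (Suc n))) \<and>
     semiring_of_sets (\<Union>(all_levels C)) (insert {} (all_levels C)) \<and>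
     sigma_sets (\<Union>(all_levels C)) (all_levels C) = sets (rank_one_space C) \<and>
     (\<forall>n. extends_column_map T (C n))"

definition normal_rank_one :: "(nat \<Rightarrow> nat) \<Rightarrow> (nat \<Rightarrow> nat \<Rightarrow> nat) \<Rightarrow> bool" where
  "normal_rank_one r s \<longleftrightarrow> infinite {n. s n (r n - 1) > 0}"

definition heights_set ::
    "(nat \<Rightarrow> nat) \<Rightarrow> (nat \<Rightarrow> nat \<Rightarrow> nat) \<Rightarrow> (nat \<Rightarrow> level_column) \<Rightarrow> nat \<Rightarrow> nat set" where
  "heights_set r s C j =
     {0} \<union> {(\<Sum>k=0..i. height (C j) + s j k) | i. i < r j - 1}"

definition all_heights ::
    "(nat \<Rightarrow> nat) \<Rightarrow> (nat \<Rightarrow> nat \<Rightarrow> nat) \<Rightarrow> (nat \<Rightarrow> level_column) \<Rightarrow> nat set" where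
  "all_heights r s C = (\<Union>j. heights_set r s C j) - {0}"

definition steep ::
    "(nat \<Rightarrow> nat) \<Rightarrow> (nat \<Rightarrow> nat \<Rightarrow> nat) \<Rightarrow> (nat \<Rightarrow> level_column) \<Rightarrow> bool" where
  "steep r s C \<longleftrightarrow>
     (\<forall>i. enumerate (all_heights r s C) (Suc i) \<ge> 4 * enumerate (all_heights r s C) i)"

definition ret_rate :: "'a measure \<Rightarrow> ('a \<Rightarrow> 'a) \<Rightarrow> 'a set \<Rightarrow> nat \<Rightarrow> real" where
  "ret_rate M T F k = measure M (F \<inter> (T ^^ k) ` F) / (measure M F)\<^sup>2"

definition ret_sum :: "'a measure \<Rightarrow> ('a \<Rightarrow> 'a) \<Rightarrow> 'a set \<Rightarrow> nat \<Rightarrow> real" where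
  "ret_sum M T F n = (\<Sum>k<n. ret_rate M T F k)"

definition rationally_weakly_mixing :: "'a measure \<Rightarrow> ('a \<Rightarrow> 'a) \<Rightarrow> bool" where
  "rationally_weakly_mixing M T \<longleftrightarrow>
     (\<exists>F\<in>sets M. 0 < emeasure M F \<and> emeasure M F < \<infinity> \<and>
        (\<forall>A\<in>sets M. \<forall>B\<in>sets M. A \<subseteq> F \<longrightarrow> B \<subseteq> F \<longrightarrow>
           (\<lambda>n. 1 / ret_sum M T F n *
              (\<Sum>k<n. \<bar>measure M (A \<inter> (T ^^ k) ` B) - measure M A * measure M B * ret_rate M T F k\<bar>))
           \<longlonglongrightarrow> 0))"

end

theory Submission
  imports Defs
begin

text \<open>
  Write two levels of \<open>C N\<close> as \<open>level (C N) i\<close> and \<open>level (C N) i'\<close>.  If \<open>T ^^ k\<close> moves a point of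
  the first into itself and another point of the first into the second, then \<open>i' - i\<close> is an integer
  combination, with coefficients between \<open>-2\<close> and \<open>2\<close>, of elements of \<open>H\<close> that are at least
  \<open>h N\<close>.  Since \<open>H\<close> grows by factors of at least 4, such a combination is \<open>0\<close> or at least \<open>h N\<close> in
  absolute value, so \<open>i = i'\<close>.  Hence if a set \<open>F\<close> meets two distinct levels in sets \<open>A\<close>, \<open>A'\<close> of
  positive measure, then for every \<open>k\<close> one of the sets \<open>A \<inter> T\<^sup>k A\<close>, \<open>A' \<inter> T\<^sup>k A\<close> is empty, and the
  errors for these two pairs cannot both be of smaller order than the return sums of \<open>F\<close>.
\<close>

section \<open>Sums over lacunary sets\<close>

text \<open>Induction on the largest element \<open>b\<close>: the smaller ones satisfy
  \<open>3 * \<Sum>A + h \<le> b\<close>, and adding \<open>3 * b\<close> gives at most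
  \<open>4 * b \<le> m\<close>. The slack \<open>h\<close> later keeps nonzero combinations away
  from 0.\<close>

lemma lacunary_sum_bound:
  fixes U :: "nat set"
  assumes "finite U" "\<And>x y. x \<in> U \<Longrightarrow> y \<in> U \<Longrightarrow> x < y \<Longrightarrow> 4 * x \<le> y" "\<And>x. x \<in> U \<Longrightarrow> h \<le> x"
    and "\<And>x. x \<in> U \<Longrightarrow> 4 * x \<le> m" "h \<le> m"
  shows "3 * \<Sum>U + h \<le> m"
  using assms
proof (induction U arbitrary: m rule: finite_linorder_max_induct)
  case empty
  then show ?case by simp
next
  case (insert b A)
  have "3 * \<Sum>A + h \<le> b"
    by (rule insert.IH) (use insert.prems insert.hyps in auto)
  moreover have "\<Sum>(insert b A) = b + \<Sum>A"
    using insert.hyps by (subst sum.insert) auto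
  moreover have "4 * b \<le> m"
    using insert.prems by simp
  ultimately show ?case by linarith
qed

text \<open>The largest element \<open>b\<close> with nonzero coefficient dominates: the terms below
  it total at most \<open>2 * \<Sum>A\<close> in absolute value, while
  \<open>3 * \<Sum>A + h \<le> b\<close>, so at least \<open>h\<close> remains.\<close>

lemma lacunary_combination:
  fixes U :: "nat set" and c :: "nat \<Rightarrow> int"
  assumes "finite U" "\<And>x y. x \<in> U \<Longrightarrow> y \<in> U \<Longrightarrow> x < y \<Longrightarrow> 4 * x \<le> y" "\<And>x. x \<in> U \<Longrightarrow> h \<le> x"
    and "\<And>x. \<bar>c x\<bar> \<le> 2"
  shows "(\<Sum>x\<in>U. c x * int x) = 0 \<or> int h \<le> \<bar>\<Sum>x\<in>U. c x * int x\<bar>"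
  using assms(1-3)
proof (induction U rule: finite_linorder_max_induct)
  case empty
  then show ?case by simp
next
  case (insert b A)
  have eq: "(\<Sum>x\<in>insert b A. c x * int x) = c b * int b + (\<Sum>x\<in>A. c x * int x)"
    using insert.hyps by (subst sum.insert) auto
  show ?case
  proof (cases "c b = 0")
    case True
    then show ?thesis
      using eq insert.IH insert.prems by simp
  next
    case False
    have "3 * \<Sum>A + h \<le> b"
      by (rule lacunary_sum_bound) (use insert.prems insert.hyps in auto)
    moreover have "\<bar>\<Sum>x\<in>A. c x * int x\<bar> \<le> (\<Sum>x\<in>A. 2 * int x)"
      by (rule sum_abs[THEN order_trans], rule sum_mono)
        (simp add: abs_mult mult_right_mono assms(4))
    moreover have "(\<Sum>x\<in>A. 2 * int x) = 2 * int (\<Sum>A)"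
      by (simp add: sum_distrib_left)
    moreover have "int b \<le> \<bar>c b * int b\<bar>"
      using False mult_right_mono[of 1 "\<bar>c b\<bar>" "int b"] by (simp add: abs_mult)
    ultimately show ?thesis
      unfolding eq by linarith
  qed
qed

text \<open>The four sets may overlap, so they are merged into one combination over their union.
  Each coefficient is a difference of two differences of indicators, hence between -2 and 2.\<close>

lemma lacunary_differences:
  fixes H :: "nat set"
  assumes lac: "\<And>x y. x \<in> H \<Longrightarrow> y \<in> H \<Longrightarrow> x < y \<Longrightarrow> 4 * x \<le> y"
    and fin: "finite P" "finite P'" "finite Q" "finite Q'"
    and sub: "P \<union> P' \<union> Q \<union> Q' \<subseteq> H \<inter> {h..}"
    and eq: "z = (int (\<Sum>P) - int (\<Sum>P')) - (int (\<Sum>Q) - int (\<Sum>Q'))"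
    and small: "\<bar>z\<bar> < int h"
  shows "z = 0"
proof -
  define U where "U = P \<union> P' \<union> Q \<union> Q'"
  define c :: "nat \<Rightarrow> int" where
    "c x = (of_bool (x \<in> P) - of_bool (x \<in> P')) - (of_bool (x \<in> Q) - of_bool (x \<in> Q'))" for x
  have U: "finite U"
    using fin by (simp add: U_def)
  have ind: "int (\<Sum>S) = (\<Sum>x\<in>U. of_bool (x \<in> S) * int x)" if "S \<subseteq> U" for S
  proof -
    have "(\<Sum>x\<in>S. int x) = (\<Sum>x\<in>U. of_bool (x \<in> S) * int x)"
      by (rule sum.mono_neutral_cong_left) (use U that in auto)
    then show ?thesis by simp
  qed
  have "z = (\<Sum>x\<in>U. c x * int x)"
    unfolding eq c_def by (subst (1 2 3 4) ind) (auto simp: U_def algebra_simps sum.distrib sum_subtractf)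
  moreover have "(\<Sum>x\<in>U. c x * int x) = 0 \<or> int h \<le> \<bar>\<Sum>x\<in>U. c x * int x\<bar>"
  proof (rule lacunary_combination)
    show "4 * x \<le> y" if "x \<in> U" "y \<in> U" "x < y" for x y
      using lac that sub unfolding U_def by blast
  qed (use U sub in \<open>auto simp: U_def c_def\<close>)
  ultimately show ?thesis
    using small by auto
qed

section \<open>Levels of successive columns\<close>

lemma nth_concat_map_upt:
  assumes "k < r" "i < length (f k)"
  shows "concat (map f [0..<r]) ! ((\<Sum>l<k. length (f l)) + i) = f k ! i"
  using assms
proof (induction r)
  case 0
  then show ?case by simp
next
  case (Suc r)
  have len: "length (concat (map f [0..<m])) = (\<Sum>l<m. length (f l))" for m
    by (induction m) auto
  show ?case
  proof (cases "k = r")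
    case True
    then show ?thesis
      using len[of r] Suc.prems by (simp add: nth_append)
  next
    case False
    then have "k < r" using Suc.prems by simp
    then have "(\<Sum>l<Suc k. length (f l)) \<le> (\<Sum>l<r. length (f l))"
      by (intro sum_mono2) auto
    then show ?thesis
      using len[of r] Suc \<open>k < r\<close> by (simp add: nth_append)
  qed
qed

locale rank_one_system =
  fixes r :: "nat \<Rightarrow> nat" and s :: "nat \<Rightarrow> nat \<Rightarrow> nat"
    and C :: "nat \<Rightarrow> level_column" and T :: "real \<Rightarrow> real"
  assumes rank_one: "rank_one r s C T"
begin

abbreviation h :: "nat \<Rightarrow> nat" where "h n \<equiv> height (C n)"
abbreviation w :: "nat \<Rightarrow> real" where "w n \<equiv> width (C n)"

text \<open>The position in \<open>C (Suc n)\<close> of the bottom level of the \<open>k\<close>-th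
  subcolumn. For \<open>0 < k < r n\<close> these are the nonzero elements of
  \<open>heights_set r s C n\<close>; for \<open>k = r n\<close> the value is the height of
  \<open>C (Suc n)\<close>.\<close>

definition offset :: "nat \<Rightarrow> nat \<Rightarrow> nat" where
  "offset n k = (\<Sum>l<k. h n + s n l)"

lemma r_ge_2: "2 \<le> r n"
  using rank_one by (auto simp: rank_one_def)

lemma width_Suc: "w (Suc n) = w n / real (r n)"
  using rank_one by (auto simp: rank_one_def cut_and_stack_def)

lemma width_pos: "0 < w n"
  using rank_one by (auto simp: rank_one_def is_column_def)

lemma
  shows height_Suc: "h (Suc n) = offset n (r n)"
    and lefts_Suc: "k < r n \<Longrightarrow> i < h n \<Longrightarrow>
      lefts (C (Suc n)) ! (offset n k + i) = lefts (C n) ! i + real k * w (Suc n)"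
proof -
  have "cut_and_stack (C n) (r n) (s n) (C (Suc n))"
    using rank_one by (simp add: rank_one_def)
  then obtain sp where sp: "\<And>k. k < r n \<Longrightarrow> length (sp k) = s n k"
    and lefts: "lefts (C (Suc n)) =
      concat (map (\<lambda>k. map (\<lambda>a. a + real k * w (Suc n)) (lefts (C n)) @ sp k) [0..<r n])"
    unfolding cut_and_stack_def width_Suc by blast
  define f where "f k = map (\<lambda>a. a + real k * w (Suc n)) (lefts (C n)) @ sp k" for k
  have off: "offset n k = (\<Sum>l<k. length (f l))" if "k \<le> r n" for k
    unfolding offset_def using that by (intro sum.cong) (auto simp: f_def height_def sp)
  have lefts_f: "lefts (C (Suc n)) = concat (map f [0..<r n])"
    using lefts by (simp add: f_def[abs_def])
  have len: "length (concat (map f [0..<m])) = (\<Sum>l<m. length (f l))" for m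
    by (induction m) auto
  then show "h (Suc n) = offset n (r n)"
    using off[of "r n"] by (simp add: height_def lefts_f)
  assume "k < r n" "i < h n"
  then show "lefts (C (Suc n)) ! (offset n k + i) = lefts (C n) ! i + real k * w (Suc n)"
    using nth_concat_map_upt[of k "r n" i f] off[of k]
    by (simp add: lefts_f f_def nth_append height_def)
qed

lemma offset_add_less:
  assumes "k < r n" "i < h n"
  shows "offset n k + i < h (Suc n)"
proof -
  have "offset n (Suc k) \<le> h (Suc n)"
    unfolding height_Suc offset_def using assms(1) by (intro sum_mono2) auto
  then show ?thesis using assms(2) by (simp add: offset_def)
qed

lemma height_double: "2 * h n \<le> h (Suc n)"
proof -
  have "2 * h n \<le> r n * h n"
    using r_ge_2[of n] by simp
  also have "\<dots> = (\<Sum>l<r n. h n)" by simp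
  also have "\<dots> \<le> h (Suc n)"
    unfolding height_Suc offset_def by (intro sum_mono) simp
  finally show ?thesis .
qed

lemma height_ge: "2 ^ n \<le> h n"
proof (induction n)
  case 0
  then show ?case using rank_one by (simp add: rank_one_def height_def)
next
  case (Suc n)
  then show ?case using height_double[of n] by simp
qed

lemma height_pos: "0 < h n"
  by (rule order.strict_trans2[OF _ height_ge]) simp

lemma height_mono: "m \<le> n \<Longrightarrow> h m \<le> h n"
proof (rule lift_Suc_mono_le[of h])
  show "h n \<le> h (Suc n)" for n
    using height_double[of n] by linarith
qed

lemma width_half: "w (Suc n) \<le> w n / 2"
  unfolding width_Suc using r_ge_2[of n] width_pos[of n] by (intro divide_left_mono) auto

lemma width_tendsto_0: "w \<longlonglongrightarrow> 0"
proof (rule tendsto_sandwich)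
  have "w n \<le> (1/2) ^ n" for n
  proof (induction n)
    case 0
    then show ?case using rank_one by (simp add: rank_one_def)
  next
    case (Suc n)
    then show ?case using width_half[of n] by simp
  qed
  then show "\<forall>\<^sub>F n in sequentially. w n \<le> (1/2) ^ n" by simp
  show "\<forall>\<^sub>F n in sequentially. 0 \<le> w n"
    using width_pos by (simp add: less_imp_le)
  show "(\<lambda>n. (1/2::real) ^ n) \<longlonglongrightarrow> 0"
    by (rule LIMSEQ_power_zero) simp
qed simp

lemma level_disjoint: "x \<in> level (C n) i \<Longrightarrow> x \<in> level (C n) j \<Longrightarrow> i < h n \<Longrightarrow> j < h n \<Longrightarrow> i = j"
  using rank_one unfolding rank_one_def is_column_def disjoint_family_on_def by blast

lemma level_split:
  assumes "i < h n" "x \<in> level (C n) i"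
  obtains k where "k < r n" "x \<in> level (C (Suc n)) (offset n k + i)"
proof -
  let ?a = "lefts (C n) ! i"
  \<comment> \<open>\<open>k\<close> counts the whole subcolumn widths to the left of
    \<open>x\<close> within its level.\<close>
  define k where "k = nat \<lfloor>(x - ?a) / w (Suc n)\<rfloor>"
  have wp: "0 < w (Suc n)" by (rule width_pos)
  have x: "?a \<le> x" "x < ?a + real (r n) * w (Suc n)"
    using assms r_ge_2[of n] by (auto simp: level_def width_Suc)
  then have k: "real k \<le> (x - ?a) / w (Suc n)" "(x - ?a) / w (Suc n) < real k + 1"
    using wp by (simp_all add: k_def)
  have "(x - ?a) / w (Suc n) < real (r n)"
    using x wp by (simp add: field_simps)
  with k have kr: "k < r n" by linarith
  moreover have "?a + real k * w (Suc n) \<le> x" "x < ?a + real k * w (Suc n) + w (Suc n)"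
    using k wp by (simp_all add: field_simps)
  then have "x \<in> level (C (Suc n)) (offset n k + i)"
    by (simp add: level_def lefts_Suc[OF kr assms(1)])
  ultimately show ?thesis by (rule that)
qed

lemma offset_cases:
  assumes "k < r n"
  shows "offset n k = 0 \<or> offset n k \<in> all_heights r s C \<and> h n \<le> offset n k"
proof (cases k)
  case 0
  then show ?thesis by (simp add: offset_def)
next
  case (Suc m)
  \<comment> \<open>The sum up to \<open>m\<close> enters \<open>heights_set\<close> exactly for
    \<open>m < r n - 1\<close>, that is, for \<open>k = Suc m < r n\<close>.\<close>
  have "offset n k = (\<Sum>l=0..m. h n + s n l)"
    unfolding offset_def Suc lessThan_Suc_atMost atMost_atLeast0 ..
  moreover have "m < r n - 1"
    using Suc assms by simp
  moreover have "h n \<le> offset n k"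
    by (simp add: offset_def Suc)
  ultimately show ?thesis
    using height_pos[of n] by (auto simp: all_heights_def heights_set_def)
qed

text \<open>Each refinement from \<open>C n\<close> to \<open>C (Suc n)\<close> raises the index of
  the level containing \<open>x\<close> by an offset that is 0 or an element of
  \<open>all_heights r s C\<close> in \<open>{h n..<h (Suc n)}\<close>. These ranges are disjoint
  for different stages, so the nonzero offsets are distinct and can be recorded as a set.\<close>

lemma descendant:
  assumes "x \<in> level (C N) i" "i < h N" "N \<le> n"
  obtains S where "finite S" "S \<subseteq> all_heights r s C \<inter> {h N..<h n}"
    "i + \<Sum>S < h n" "x \<in> level (C n) (i + \<Sum>S)"
proof -
  have "\<exists>S. finite S \<and> S \<subseteq> all_heights r s C \<inter> {h N..<h n} \<and>
      i + \<Sum>S < h n \<and> x \<in> level (C n) (i + \<Sum>S)"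
    using assms(3)
  proof (induction n rule: dec_induct)
    case base
    then show ?case using assms by (intro exI[of _ "{}"]) simp
  next
    case (step n)
    then obtain S where S: "finite S" "S \<subseteq> all_heights r s C \<inter> {h N..<h n}"
      "i + \<Sum>S < h n" "x \<in> level (C n) (i + \<Sum>S)" by blast
    obtain k where k: "k < r n" "x \<in> level (C (Suc n)) (offset n k + (i + \<Sum>S))"
      using level_split[OF S(3,4)] by blast
    have less: "offset n k + (i + \<Sum>S) < h (Suc n)"
      using offset_add_less[OF k(1) S(3)] .
    have mono: "h N \<le> h n" "h n \<le> h (Suc n)"
      using height_mono step.hyps by auto
    consider "offset n k = 0" | "offset n k \<in> all_heights r s C" "h n \<le> offset n k"
      using offset_cases[OF k(1)] by auto
    then show ?case
    proof cases
      case 1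
      then show ?thesis
        using S k less mono by (intro exI[of _ S]) auto
    next
      case 2
      \<comment> \<open>The old elements lie below \<open>h n\<close> and the new offset does not,
        so it is not yet in \<open>S\<close>.\<close>
      then have "\<Sum>(insert (offset n k) S) = offset n k + \<Sum>S"
        using S by (subst sum.insert) auto
      then show ?thesis
        using 2 S k less mono by (intro exI[of _ "insert (offset n k) S"]) (auto simp: ac_simps)
    qed
  qed
  then show ?thesis using that by blast
qed

section \<open>Orbits inside columns\<close>

lemma funpow_level:
  assumes "x \<in> level (C n) p" "p + k < h n"
  shows "(T ^^ k) x \<in> level (C n) (p + k)"
  using assms(2)
proof (induction k)
  case 0
  then show ?case using assms(1) by simp
next
  case (Suc k)
  then have "(T ^^ k) x \<in> level (C n) (p + k)" by simp
  moreover have "extends_column_map T (C n)"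
    using rank_one by (simp add: rank_one_def)
  ultimately show ?case
    using Suc.prems by (auto simp: extends_column_map_def level_def)
qed

text \<open>
  A point that stays in the last subcolumn from some stage on would lie in a nested sequence of
  half-open intervals that shrink to their common right endpoint.
\<close>

lemma eventually_room_above:
  assumes "x \<in> level (C N) i" "i < h N"
  obtains n where "N \<le> n" "\<And>p. x \<in> level (C n) p \<Longrightarrow> p < h n \<Longrightarrow> p + k < h n"
proof -
  have ex: "\<exists>p. p < h n \<and> x \<in> level (C n) p" if "N \<le> n" for n
    using descendant[OF assms that] by blast
  define pos where "pos n = (SOME p. p < h n \<and> x \<in> level (C n) p)" for n
  have pos: "pos n < h n" "x \<in> level (C n) (pos n)" if "N \<le> n" for n
    using someI_ex[OF ex[OF that]] by (auto simp: pos_def)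
  have pos_eq: "p = pos n" if "N \<le> n" "p < h n" "x \<in> level (C n) p" for n p
    using level_disjoint that pos by blast
  have "\<exists>n\<ge>N. pos n + k < h n"
  proof (rule ccontr)
    assume "\<not> ?thesis"
    then have no_room: "h n \<le> pos n + k" if "N \<le> n" for n
      using that by (auto simp: not_less)
    \<comment> \<open>From stage \<open>M\<close> on,
      \<open>k \<le> n < 2 ^ n \<le> h n\<close>.\<close>
    define M where "M = max N k"
    define right where "right n = lefts (C n) ! pos n + w n" for n
    have right_Suc: "right (Suc n) = right n" if n: "M \<le> n" for n
    proof -
      have Nn: "N \<le> n" "N \<le> Suc n" using n by (auto simp: M_def)
      obtain j where j: "j < r n" "x \<in> level (C (Suc n)) (offset n j + pos n)"
        using level_split[OF pos[OF Nn(1)]] by blast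
      have pS: "pos (Suc n) = offset n j + pos n"
        using pos_eq[OF Nn(2) _ j(2)] offset_add_less[OF j(1) pos(1)[OF Nn(1)]] by simp
      have "k < h n"
        using n height_ge[of n] less_exp[of n] unfolding M_def by linarith
      \<comment> \<open>A further subcolumn to the right would be stacked above and put at least
        \<open>h n > k\<close> levels over \<open>x\<close>.\<close>
      have "\<not> Suc j < r n"
      proof
        assume "Suc j < r n"
        then have "offset n (Suc j) + pos n < h (Suc n)"
          using offset_add_less pos(1)[OF Nn(1)] by blast
        then show False
          using pS no_room[OF Nn(2)] \<open>k < h n\<close> by (simp add: offset_def)
      qed
      then have "r n = Suc j" using j(1) by simp
      moreover have "w n = real (r n) * w (Suc n)"
        using r_ge_2[of n] by (simp add: width_Suc)
      ultimately show ?thesis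
        unfolding right_def pS lefts_Suc[OF j(1) pos(1)[OF Nn(1)]] by (simp add: algebra_simps)
    qed
    have const: "right n = right M" if "M \<le> n" for n
      using that by (induction n rule: dec_induct) (simp_all add: right_Suc)
    have "right M - x \<le> w n" if "M \<le> n" for n
    proof -
      have "x \<in> level (C n) (pos n)" using that pos(2) by (simp add: M_def)
      then show ?thesis using const[OF that] by (simp add: right_def level_def)
    qed
    then have "right M - x \<le> 0"
      by (intro LIMSEQ_le_const[OF width_tendsto_0]) auto
    moreover have "x < right M"
      using pos(2)[of M] by (simp add: right_def level_def M_def)
    ultimately show False by simp
  qed
  then show ?thesis using that pos_eq by blast
qed

text \<open>In a column with room for \<open>k\<close> further steps the level index rises by
  exactly \<open>k\<close>. \<open>P\<close> and \<open>Q\<close> record how the starting point and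
  the end point descend into that column.\<close>

lemma return_time:
  assumes "x \<in> level (C N) i" "i < h N" "(T ^^ k) x \<in> level (C N) j" "j < h N"
  obtains P Q where "finite P" "finite Q" "P \<union> Q \<subseteq> all_heights r s C \<inter> {h N..}"
    "i + \<Sum>P + k = j + \<Sum>Q"
proof -
  obtain n where n: "N \<le> n" and room: "\<And>p. x \<in> level (C n) p \<Longrightarrow> p < h n \<Longrightarrow> p + k < h n"
    using eventually_room_above[OF assms(1,2)] by blast
  obtain P where P: "finite P" "P \<subseteq> all_heights r s C \<inter> {h N..<h n}"
    "i + \<Sum>P < h n" "x \<in> level (C n) (i + \<Sum>P)"
    using descendant[OF assms(1,2) n] .
  obtain Q where Q: "finite Q" "Q \<subseteq> all_heights r s C \<inter> {h N..<h n}"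
    "j + \<Sum>Q < h n" "(T ^^ k) x \<in> level (C n) (j + \<Sum>Q)"
    using descendant[OF assms(3,4) n] .
  have "i + \<Sum>P + k = j + \<Sum>Q"
    using level_disjoint funpow_level room P Q by blast
  with P Q show ?thesis by (intro that[of P Q]) auto
qed

section \<open>Steepness and simultaneous return times\<close>

lemma infinite_all_heights: "infinite (all_heights r s C)"
proof
  assume "finite (all_heights r s C)"
  then obtain b where b: "\<And>t. t \<in> all_heights r s C \<Longrightarrow> t \<le> b"
    by (metis finite_nat_set_iff_bounded_le)
  \<comment> \<open>The supposed bound \<open>b\<close> serves as the stage:
    \<open>offset b 1\<close> is in the set and is at least
    \<open>h b \<ge> 2 ^ b > b\<close>.\<close>
  have "1 < r b" using r_ge_2[of b] by simp
  moreover have "b < h b"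
    by (rule order.strict_trans2[OF less_exp height_ge])
  then have "b < offset b 1"
    by (simp add: offset_def)
  ultimately show False
    using offset_cases[of 1 b] b by fastforce
qed

text \<open>The step from index \<open>a\<close> to \<open>Suc a\<close> already gives the factor 4,
  and the enumeration of the infinite set only increases from there to \<open>b\<close>.\<close>

lemma steep_lacunary:
  assumes "steep r s C" "x \<in> all_heights r s C" "y \<in> all_heights r s C" "x < y"
  shows "4 * x \<le> y"
proof -
  let ?H = "all_heights r s C"
  obtain a b where ab: "x = enumerate ?H a" "y = enumerate ?H b"
    using assms(2,3) enumerate_Ex[OF infinite_all_heights] by metis
  have "a < b"
    using assms(4) infinite_all_heights ab by (simp add: enumerate_mono_iff)
  then have "enumerate ?H (Suc a) \<le> y"
    using infinite_all_heights by (simp add: ab enumerate_mono_le_iff)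
  moreover have "4 * x \<le> enumerate ?H (Suc a)"
    using assms(1) by (simp add: ab steep_def)
  ultimately show ?thesis by simp
qed

text \<open>Both return equations contain the same \<open>k\<close>. Subtracting them expresses
  \<open>j - i\<close> through four sums over a lacunary set with elements at least
  \<open>h N\<close>, and \<open>j - i\<close> is too small for a nonzero value.\<close>

lemma common_return_time:
  assumes steep: "steep r s C"
    and "x \<in> level (C N) i" "(T ^^ k) x \<in> level (C N) i"
    and "y \<in> level (C N) i" "(T ^^ k) y \<in> level (C N) j"
    and "i < h N" "j < h N"
  shows "i = j"
proof -
  obtain P P' where P: "finite P" "finite P'" "P \<union> P' \<subseteq> all_heights r s C \<inter> {h N..}"
    "i + \<Sum>P + k = i + \<Sum>P'"
    using return_time[of x N i k i] assms by metis
  obtain Q Q' where Q: "finite Q" "finite Q'" "Q \<union> Q' \<subseteq> all_heights r s C \<inter> {h N..}"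
    "i + \<Sum>Q + k = j + \<Sum>Q'"
    using return_time[of y N i k j] assms by metis
  have "int j - int i = 0"
  proof (rule lacunary_differences)
    show "\<And>x y. x \<in> all_heights r s C \<Longrightarrow> y \<in> all_heights r s C \<Longrightarrow> x < y \<Longrightarrow> 4 * x \<le> y"
      by (rule steep_lacunary[OF steep])
    show "P' \<union> P \<union> Q' \<union> Q \<subseteq> all_heights r s C \<inter> {h N..}"
      using P(3) Q(3) by blast
    show "int j - int i = (int (\<Sum>P') - int (\<Sum>P)) - (int (\<Sum>Q') - int (\<Sum>Q))"
      using P(4) Q(4) by linarith
    show "\<bar>int j - int i\<bar> < int (h N)"
      using assms by linarith
  qed (use P Q in auto)
  then show ?thesis by simp
qed

section \<open>Measure\<close>

lemma level_borel: "level (C n) i \<in> sets borel"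
  by (simp add: level_def)

lemma Union_all_levels: "\<Union>(all_levels C) = (\<Union>n. \<Union>i<h n. level (C n) i)"
  by (auto simp: all_levels_def)

lemma
  shows sets_rank_one_space:
      "sets (rank_one_space C) = {A. A \<in> sets borel \<and> A \<subseteq> \<Union>(all_levels C)}"
    and emeasure_rank_one_space:
      "A \<subseteq> \<Union>(all_levels C) \<Longrightarrow> emeasure (rank_one_space C) A = emeasure lborel A"
proof -
  have "\<Union>(all_levels C) \<in> sets borel"
    unfolding Union_all_levels by (intro sets.countable_UN sets.finite_UN) (auto simp: level_borel)
  then show "sets (rank_one_space C) = {A. A \<in> sets borel \<and> A \<subseteq> \<Union>(all_levels C)}"
    "A \<subseteq> \<Union>(all_levels C) \<Longrightarrow> emeasure (rank_one_space C) A = emeasure lborel A"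
    unfolding rank_one_space_def
    by (auto simp: sets_restrict_space_iff emeasure_restrict_space simp del: Union_iff)
qed

text \<open>Some level of a column \<open>C m\<close> meets \<open>F\<close> in positive measure
  \<open>g\<close>. Once the levels of a later column are narrower than \<open>g\<close>, no single
  one can hold that much mass.\<close>

lemma two_levels:
  assumes F: "F \<in> sets (rank_one_space C)" "0 < emeasure (rank_one_space C) F"
  obtains N i j where "i < h N" "j < h N" "i \<noteq> j"
    "0 < emeasure (rank_one_space C) (F \<inter> level (C N) i)"
    "0 < emeasure (rank_one_space C) (F \<inter> level (C N) j)"
proof -
  have Fb: "F \<in> sets borel" "F \<subseteq> (\<Union>n. \<Union>i<h n. level (C n) i)"
    using F(1) by (auto simp: sets_rank_one_space Union_all_levels)
  have em: "emeasure (rank_one_space C) (F \<inter> A) = emeasure lborel (F \<inter> A)" for A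
    using F(1) by (intro emeasure_rank_one_space) (auto simp: sets_rank_one_space)
  have meas: "F \<inter> level (C n) i \<in> sets lborel" for n i
    using Fb level_borel by auto
  have "\<exists>m. \<exists>i<h m. 0 < emeasure lborel (F \<inter> level (C m) i)"
  proof (rule ccontr)
    assume "\<not> ?thesis"
    then have null: "F \<inter> level (C m) i \<in> null_sets lborel" if "i < h m" for m i
      using that meas by (auto simp: null_sets_def)
    have "(\<Union>m. \<Union>i\<in>{..<h m}. F \<inter> level (C m) i) \<in> null_sets lborel"
      by (intro null_sets_UN' null_sets.finite_UN) (auto intro: null)
    also have "(\<Union>m. \<Union>i\<in>{..<h m}. F \<inter> level (C m) i) = F"
      using Fb(2) by auto
    finally show False
      using F(2) em[of UNIV] by (simp add: null_setsD1)
  qed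
  then obtain m a where a: "a < h m" "0 < emeasure lborel (F \<inter> level (C m) a)" by blast
  \<comment> \<open>Restricting to one level makes the measure finite and keeps the set inside every
    later column; \<open>F\<close> itself may also lie in spacers added after stage
    \<open>N\<close>.\<close>
  define G where "G = F \<inter> level (C m) a"
  have "emeasure lborel G \<le> emeasure lborel (level (C m) a)"
    unfolding G_def using level_borel by (intro emeasure_mono) auto
  also have "\<dots> = ennreal (w m)"
    using width_pos[of m] by (simp add: level_def)
  finally obtain g where g: "emeasure lborel G = ennreal g" "0 \<le> g"
    by (metis ennreal_cases ennreal_less_top linorder_not_less)
  with a have "0 < g" by (simp add: G_def)
  then obtain N0 where "\<And>n. N0 \<le> n \<Longrightarrow> w n < g"
    using order_tendstoD(2)[OF width_tendsto_0] by (meson eventually_sequentially)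
  then obtain N where N: "m \<le> N" "w N < g"
    by (metis max.cobounded1 max.cobounded2)
  have cover: "G \<subseteq> (\<Union>i\<in>{..<h N}. F \<inter> level (C N) i)"
  proof
    fix x assume "x \<in> G"
    then have "x \<in> F" "x \<in> level (C m) a" by (auto simp: G_def)
    from descendant[OF this(2) a(1) N(1)] obtain S where "a + \<Sum>S < h N" "x \<in> level (C N) (a + \<Sum>S)" .
    with \<open>x \<in> F\<close> show "x \<in> (\<Union>i\<in>{..<h N}. F \<inter> level (C N) i)" by blast
  qed
  have "emeasure lborel G \<le> (\<Sum>i<h N. emeasure lborel (F \<inter> level (C N) i))"
    by (intro order_trans[OF emeasure_mono[OF cover]] emeasure_subadditive_finite sets.finite_UN)
      (use meas in auto)
  moreover have "ennreal (w N) < emeasure lborel G"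
    using N width_pos[of N] by (simp add: g ennreal_less_iff)
  ultimately have big: "ennreal (w N) < (\<Sum>i<h N. emeasure lborel (F \<inter> level (C N) i))"
    by simp
  then have "(\<Sum>i<h N. emeasure lborel (F \<inter> level (C N) i)) \<noteq> 0"
    using not_less_zero by metis
  then obtain i where i: "i < h N" "0 < emeasure lborel (F \<inter> level (C N) i)"
    by (meson lessThan_iff not_gr_zero sum.neutral)
  have "\<exists>j<h N. j \<noteq> i \<and> 0 < emeasure lborel (F \<inter> level (C N) j)"
  proof (rule ccontr)
    assume "\<not> ?thesis"
    then have zero: "emeasure lborel (F \<inter> level (C N) j) = 0" if "j < h N" "j \<noteq> i" for j
      using that by auto
    \<comment> \<open>If level \<open>i\<close> alone carried mass, the whole sum would be at most
      one level width \<open>w N\<close>.\<close>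
    have "(\<Sum>j<h N. emeasure lborel (F \<inter> level (C N) j)) = emeasure lborel (F \<inter> level (C N) i)"
      using i(1) zero by (subst sum.remove[of _ i]) auto
    also have "\<dots> \<le> emeasure lborel (level (C N) i)"
      using level_borel by (intro emeasure_mono) auto
    also have "\<dots> = ennreal (w N)"
      using width_pos[of N] by (simp add: level_def)
    finally show False using big by simp
  qed
  then show ?thesis using i that em by metis
qed

end

section \<open>A criterion excluding rational weak mixing\<close>

text \<open>An empty intersection makes the error equal to the product of the two measures times
  \<open>ret_rate M T F k\<close>. Since one of the two intersections is empty for each
  \<open>k\<close>, the two error sums together stay above a fixed multiple of
  \<open>ret_sum M T F n\<close>.\<close>

lemma not_rationally_weakly_mixing_if_exclusive:
  assumes "\<And>F. F \<in> sets M \<Longrightarrow> 0 < emeasure M F \<Longrightarrow> emeasure M F < \<infinity> \<Longrightarrow>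
    \<exists>A\<in>sets M. \<exists>A'\<in>sets M. A \<subseteq> F \<and> A' \<subseteq> F \<and> 0 < emeasure M A \<and> 0 < emeasure M A' \<and>
      (\<forall>k. A \<inter> (T ^^ k) ` A = {} \<or> A' \<inter> (T ^^ k) ` A = {})"
  shows "\<not> rationally_weakly_mixing M T"
proof
  assume "rationally_weakly_mixing M T"
  then obtain F where F: "F \<in> sets M" "0 < emeasure M F" "emeasure M F < \<infinity>"
    and mix: "\<forall>A\<in>sets M. \<forall>B\<in>sets M. A \<subseteq> F \<longrightarrow> B \<subseteq> F \<longrightarrow>
      (\<lambda>n. 1 / ret_sum M T F n *
        (\<Sum>k<n. \<bar>measure M (A \<inter> (T ^^ k) ` B) - measure M A * measure M B * ret_rate M T F k\<bar>))
      \<longlonglongrightarrow> 0"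
    unfolding rationally_weakly_mixing_def by (elim bexE conjE) (rule that; assumption)
  obtain A A' where A: "A \<in> sets M" "A' \<in> sets M" "A \<subseteq> F" "A' \<subseteq> F"
    "0 < emeasure M A" "0 < emeasure M A'"
    and excl: "\<And>k. A \<inter> (T ^^ k) ` A = {} \<or> A' \<inter> (T ^^ k) ` A = {}"
    using assms[OF F] by blast
  have pos: "0 < measure M B" if "B \<in> sets M" "B \<subseteq> F" "0 < emeasure M B" for B
  proof -
    have "emeasure M B < \<infinity>"
      using emeasure_mono[OF that(2) F(1)] F(3) by simp
    then show ?thesis
      using that(3) by (simp add: measure_def enn2real_positive_iff)
  qed
  define u where "u = ret_rate M T F"
  define a where "a = ret_sum M T F"
  define e where "e B k = \<bar>measure M (B \<inter> (T ^^ k) ` A) - measure M B * measure M A * u k\<bar>" for B k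
  define c where "c = min (measure M A * measure M A) (measure M A' * measure M A)"
  have c: "0 < c"
    using pos A by (simp add: c_def)
  have u_nonneg: "0 \<le> u k" for k
    by (simp add: u_def ret_rate_def)
  \<comment> \<open>\<open>T ^^ 0\<close> is the identity, so \<open>u 0\<close> is the reciprocal
    of the measure of \<open>F\<close>. This makes \<open>a n\<close> positive from
    \<open>n = 1\<close> on.\<close>
  have "0 < u 0"
    using pos[of F] F by (simp add: u_def ret_rate_def)
  have a_pos: "0 < a n" if "0 < n" for n
  proof -
    have "u 0 \<le> (\<Sum>k<n. u k)"
      using that u_nonneg by (intro member_le_sum) auto
    then show ?thesis
      using \<open>0 < u 0\<close> by (simp add: a_def ret_sum_def u_def)
  qed
  have "c * u k \<le> e A k + e A' k" for k
  proof -
    have "c * u k \<le> measure M A * measure M A * u k" "c * u k \<le> measure M A' * measure M A * u k"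
      using u_nonneg by (auto simp: c_def intro!: mult_right_mono)
    then show ?thesis
      using excl[of k] u_nonneg[of k] by (auto simp: e_def abs_mult)
  qed
  then have "c * a n \<le> (\<Sum>k<n. e A k) + (\<Sum>k<n. e A' k)" for n
    by (simp add: a_def ret_sum_def u_def sum_distrib_left sum_mono flip: sum.distrib)
  then have lower: "c \<le> 1 / a n * (\<Sum>k<n. e A k) + 1 / a n * (\<Sum>k<n. e A' k)" if "0 < n" for n
    using a_pos[OF that] by (simp add: field_simps)
  \<comment> \<open>The mixing condition is used for the pairs \<open>(A, A)\<close> and
    \<open>(A', A)\<close>.\<close>
  have "(\<lambda>n. 1 / a n * (\<Sum>k<n. e A k) + 1 / a n * (\<Sum>k<n. e A' k)) \<longlonglongrightarrow> 0 + 0"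
    unfolding a_def e_def u_def using A by (intro tendsto_add mix[rule_format]) auto
  then have "c \<le> 0 + 0"
    \<comment> \<open>The bound starts at 1, because \<open>a 0 = 0\<close> and division by zero
      gives 0.\<close>
    by (rule LIMSEQ_le_const) (use lower in \<open>auto intro!: exI[of _ 1]\<close>)
  then show False using c by simp
qed

theorem theorem3p4:
  fixes r :: "nat \<Rightarrow> nat" and s :: "nat \<Rightarrow> nat \<Rightarrow> nat"
    and C :: "nat \<Rightarrow> level_column" and T :: "real \<Rightarrow> real"
  assumes "rank_one r s C T"
    and "normal_rank_one r s"
    and "steep r s C"
  shows "\<not> rationally_weakly_mixing (rank_one_space C) T"
proof (rule not_rationally_weakly_mixing_if_exclusive)
  interpret rank_one_system r s C T
    by unfold_locales (fact assms(1))
  let ?M = "rank_one_space C"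
  fix F assume F: "F \<in> sets ?M" "0 < emeasure ?M F"
  obtain N i j where ij: "i < h N" "j < h N" "i \<noteq> j"
    "0 < emeasure ?M (F \<inter> level (C N) i)" "0 < emeasure ?M (F \<inter> level (C N) j)"
    using two_levels[OF F] .
  let ?A = "F \<inter> level (C N) i" and ?A' = "F \<inter> level (C N) j"
  have sets: "?A \<in> sets ?M" "?A' \<in> sets ?M"
    using F(1) level_borel by (auto simp: sets_rank_one_space)
  \<comment> \<open>If both intersections were nonempty, one point of \<open>?A\<close> would return
    to level \<open>i\<close> and another would reach level \<open>j\<close> at the same time
    \<open>k\<close>, which forces \<open>i = j\<close>.\<close>
  have "?A \<inter> (T ^^ k) ` ?A = {} \<or> ?A' \<inter> (T ^^ k) ` ?A = {}" for k
    using common_return_time[OF assms(3) _ _ _ _ ij(1,2), of _ k] ij(3) by blast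
  then show "\<exists>A\<in>sets ?M. \<exists>A'\<in>sets ?M. A \<subseteq> F \<and> A' \<subseteq> F \<and> 0 < emeasure ?M A \<and> 0 < emeasure ?M A' \<and>
      (\<forall>k. A \<inter> (T ^^ k) ` A = {} \<or> A' \<inter> (T ^^ k) ` A = {})"
    using sets ij(4,5) by (intro bexI[of _ ?A] bexI[of _ ?A']) auto
qed

end
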